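(* Let $P(\lambda)=A_m\lambda^m+\cdots+A_1\lambda+A_0$ be an $n\times n$ matrix polynomial with $A_0,\dots,A_m\in\mathbb{C}^{n\times n}$, $A_m\neq 0$, and $\det P(\lambda)$ not identically zero. Then all (finite and infinite) eigenvalues of $P(\lambda)$ lie in the CKV inclusion-exclusion set $\Xi(P(\lambda))$.
   Context: A finite eigenvalue of $P(\lambda)$ is $\mu\in\mathbb{C}$ with $\det P(\mu)=0$. The reverse matrix polynomial is $\widehat{P}(\lambda)=A_0\lambda^m+A_1\lambda^{m-1}+\cdots+A_m$; $\infty$ is an eigenvalue of $P(\lambda)$ iff $0$ is an eigenvalue of $\widehat{P}(\lambda)$, i.e. iff $A_m=\widehat{P}(0)$ is singular. By convention, $\infty$ lies in $\Xi(P(\lambda))$ iff $0\in\Xi(\widehat{P}(\lambda))$ (the set below formed for the coefficients of $\widehat{P}$), i.e. iff the inequalities below describing membership of $\mu$ hold with the constant matrix $P(\mu)$ replaced by $A_m$. Let $N=\{1,\dots,n\}$, $\overline{S}=N\setminus S$. For a constant matrix $B=[b_{ij}]\in\mathbb{C}^{n\times n}$, $i\in N$, $T\subseteq N$, put $r_i^T(B)=\sum_{j\in T\setminus\{i\}}|b_{ij}|$ and $r_i(B)=r_i^N(B)$. For $\emptyset\ne S\subsetneq N$, $i\in S$, $j\in\overline{S}$, define \[ W_{ij}^S(P(\lambda))=\Big\{\mu\in\mathbb{C}: \max\{0,|(P(\mu))_{ii}|-r_i^S(P(\mu))\}\cdot\max\{0,|(P(\mu))_{jj}|-r_j^{\overline{S}}(P(\mu))\}\le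 r_i^{\overline{S}}(P(\mu))\,r_j^S(P(\mu))\Big\}, \] \[ \begin{aligned} \Psi_{ij}^S(P(\lambda))=\Big\{\mu\in\mathbb{C}:\ &\big(|(P(\mu))_{ii}|+r_i^S(P(\mu))\big)\big(|(P(\mu))_{jj}|+r_j^{\overline{S}}(P(\mu))\big)\\ &<\max\{0,2|(P(\mu))_{ij}|-r_i^{\overline{S}}(P(\mu))\}\cdot\max\{0,2|(P(\mu))_{ji}|-r_j^S(P(\mu))\}\Big\}. \end{aligned} \] Set $\Xi^S(P(\lambda))=\bigcup_{i\in S,\,j\in\overline{S}}\big(W_{ij}^S(P(\lambda))\setminus\Psi_{ij}^S(P(\lambda))\big)$ for $\emptyset\neq S\subsetneq N$, and $\Xi^N(P(\lambda))=\Omega(P(\lambda))$, where \[ \Omega(P(\lambda))=\bigcup_{i\in N}\big(\Gamma_i(P(\lambda))\setminus\Delta_i(P(\lambda))\big), \] $\Gamma_i(P(\lambda))=\{\mu\in\mathbb{C}:|(P(\mu))_{ii}|\le r_i(P(\mu))\}$, and $\Delta_i(P(\lambda))=\bigcup_{j\in N\setminus\{i\}}\{\mu\in\mathbb{C}:|(P(\mu))_{jj}|<2|(P(\mu))_{ji}|-r_j(P(\mu))\}$. Finally \[ \Xi(P(\lambda))=\bigcap_{\emptyset\neq S\subseteq N}\Xi^S(P(\lambda)). \] *)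

theory Defs
  imports "HOL-Analysis.Analysis"
begin

text \<open>
  A matrix polynomial \<open>A\<^sub>m \<lambda>\<^sup>m + \<dots> + A\<^sub>0\<close> is given by its formal degree \<open>m\<close> and its coefficient
  sequence \<open>A\<close>, of which only \<open>A 0, \<dots>, A m\<close> are relevant. The index set \<open>N = {1, \<dots>, n}\<close> is the
  universe of the finite index type \<open>'n\<close>, so \<open>- S\<close> is the complement of \<open>S\<close> in \<open>N\<close>.
\<close>

definition mpoly_eval :: "nat \<Rightarrow> (nat \<Rightarrow> complex^'n^'n) \<Rightarrow> complex \<Rightarrow> complex^'n^'n" where
  "mpoly_eval m A z = (\<chi> i j. \<Sum>k\<le>m. A k $ i $ j * z ^ k)"

definition mpoly_reverse :: "nat \<Rightarrow> (nat \<Rightarrow> complex^'n^'n) \<Rightarrow> nat \<Rightarrow> complex^'n^'n" where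
  "mpoly_reverse m A = (\<lambda>k. A (m - k))"

datatype ext_complex = Fin complex | Infty

definition finite_eigenvalue :: "(complex \<Rightarrow> complex^'n^'n) \<Rightarrow> complex \<Rightarrow> bool" where
  "finite_eigenvalue P \<mu> \<longleftrightarrow> det (P \<mu>) = 0"

fun mpoly_eigenvalue :: "nat \<Rightarrow> (nat \<Rightarrow> complex^'n^'n) \<Rightarrow> ext_complex \<Rightarrow> bool" where
  "mpoly_eigenvalue m A (Fin \<mu>) \<longleftrightarrow> finite_eigenvalue (mpoly_eval m A) \<mu>"
| "mpoly_eigenvalue m A Infty \<longleftrightarrow> finite_eigenvalue (mpoly_eval m (mpoly_reverse m A)) 0"

lemma mpoly_eval_reverse_0: "mpoly_eval m (mpoly_reverse m A) 0 = A m"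
  by (simp add: mpoly_eval_def mpoly_reverse_def vec_eq_iff power_0_left if_distrib cong: if_cong)

lemma mpoly_eigenvalue_Infty_iff: "mpoly_eigenvalue m A Infty \<longleftrightarrow> det (A m) = 0"
  by (simp add: finite_eigenvalue_def mpoly_eval_reverse_0)

definition row_sum :: "'n set \<Rightarrow> complex^'n^'n \<Rightarrow> 'n \<Rightarrow> real" where
  "row_sum T B i = (\<Sum>j\<in>T - {i}. cmod (B $ i $ j))"

definition W_set :: "'n set \<Rightarrow> 'n \<Rightarrow> 'n \<Rightarrow> (complex \<Rightarrow> complex^'n^'n) \<Rightarrow> complex set" where
  "W_set S i j P = {\<mu>.
     max 0 (cmod (P \<mu> $ i $ i) - row_sum S (P \<mu>) i) *
     max 0 (cmod (P \<mu> $ j $ j) - row_sum (- S) (P \<mu>) j)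
     \<le> row_sum (- S) (P \<mu>) i * row_sum S (P \<mu>) j}"

definition Psi_set :: "'n set \<Rightarrow> 'n \<Rightarrow> 'n \<Rightarrow> (complex \<Rightarrow> complex^'n^'n) \<Rightarrow> complex set" where
  "Psi_set S i j P = {\<mu>.
     (cmod (P \<mu> $ i $ i) + row_sum S (P \<mu>) i) *
     (cmod (P \<mu> $ j $ j) + row_sum (- S) (P \<mu>) j)
     < max 0 (2 * cmod (P \<mu> $ i $ j) - row_sum (- S) (P \<mu>) i) *
       max 0 (2 * cmod (P \<mu> $ j $ i) - row_sum S (P \<mu>) j)}"

definition Gamma_set :: "'n \<Rightarrow> (complex \<Rightarrow> complex^'n^'n) \<Rightarrow> complex set" where
  "Gamma_set i P = {\<mu>. cmod (P \<mu> $ i $ i) \<le> row_sum UNIV (P \<mu>) i}"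

definition Delta_set :: "'n \<Rightarrow> (complex \<Rightarrow> complex^'n^'n) \<Rightarrow> complex set" where
  "Delta_set i P = (\<Union>j\<in>UNIV - {i}.
     {\<mu>. cmod (P \<mu> $ j $ j) < 2 * cmod (P \<mu> $ j $ i) - row_sum UNIV (P \<mu>) j})"

definition Omega_set :: "(complex \<Rightarrow> complex^'n^'n) \<Rightarrow> complex set" where
  "Omega_set P = (\<Union>i. Gamma_set i P - Delta_set i P)"

definition Xi_S :: "'n set \<Rightarrow> (complex \<Rightarrow> complex^'n^'n) \<Rightarrow> complex set" where
  "Xi_S S P = (if S = UNIV then Omega_set P
               else (\<Union>i\<in>S. \<Union>j\<in>- S. W_set S i j P - Psi_set S i j P))"

definition Xi_finite :: "(complex \<Rightarrow> complex^'n^'n) \<Rightarrow> complex set" where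
  "Xi_finite P = (\<Inter>S\<in>{S. S \<noteq> {}}. Xi_S S P)"

definition CKV_set :: "nat \<Rightarrow> (nat \<Rightarrow> complex^'n^'n) \<Rightarrow> ext_complex set" where
  "CKV_set m A = Fin ` Xi_finite (mpoly_eval m A) \<union>
     {e. e = Infty \<and> 0 \<in> Xi_finite (mpoly_eval m (mpoly_reverse m A))}"

end

theory Submission
  imports Defs
begin

text \<open>
  Fix \<open>B\<close> singular with null vector \<open>x\<close>. For a proper nonempty \<open>S\<close>, let \<open>i\<close> and \<open>j\<close> be the
  positions of the largest entries of \<open>x\<close> on \<open>S\<close> and on \<open>- S\<close>, with moduli \<open>a\<close> and \<open>b\<close>, not
  both zero. Isolating the diagonal entry in rows \<open>i\<close> and \<open>j\<close> of \<open>B x = 0\<close> bounds \<open>a\<close> by \<open>b\<close> and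
  vice versa, and multiplying the two bounds gives the inequality of \<open>W\<close>. Isolating the entries at
  \<open>(i, j)\<close> and \<open>(j, i)\<close> instead gives the failure of the inequality of \<open>\<Psi>\<close>. The case \<open>S = N\<close> uses
  a single largest entry in the same way.
\<close>

lemma singular_obtains_null_vector:
  fixes B :: "'a::field^'n^'n"
  assumes "det B = 0"
  obtains x where "B *v x = 0" "x \<noteq> 0"
proof -
  have "\<not> (\<exists>C. C ** B = mat 1)"
    using assms invertible_det_nz invertible_left_inverse by blast
  then show ?thesis
    using that by (auto simp: matrix_left_invertible_ker)
qed

lemma norm_maximal_index:
  fixes x :: "'a::real_normed_vector^'n"
  assumes "S \<noteq> {}"
  obtains i where "i \<in> S" "\<And>l. l \<in> S \<Longrightarrow> norm (x $ l) \<le> norm (x $ i)"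
proof -
  have "Max ((\<lambda>l. norm (x $ l)) ` S) \<in> (\<lambda>l. norm (x $ l)) ` S"
    using assms by (intro Max_in) auto
  then obtain i where "i \<in> S" "Max ((\<lambda>l. norm (x $ l)) ` S) = norm (x $ i)"
    by auto
  moreover have "norm (x $ l) \<le> Max ((\<lambda>l. norm (x $ l)) ` S)" if "l \<in> S" for l
    using that by (intro Max_ge) auto
  ultimately show ?thesis
    using that by metis
qed

lemma row_sum_nonneg: "row_sum T B i \<ge> 0"
  by (simp add: row_sum_def sum_nonneg)

text \<open>In row \<open>i\<close> of \<open>B *v x = 0\<close> the term of column \<open>k\<close>
  is minus the sum of the others, so the triangle inequality applies. The column is left free:
  \<open>k = i\<close> serves the Gershgorin-type sets, \<open>k \<noteq> i\<close> the excluded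
  ones.\<close>

lemma norm_entry_le_rest:
  fixes B :: "complex^'n^'m"
  assumes "B *v x = 0"
  shows "cmod (B $ i $ k) * cmod (x $ k) \<le> (\<Sum>l\<in>UNIV - {k}. cmod (B $ i $ l) * cmod (x $ l))"
proof -
  have "(\<Sum>l\<in>UNIV. B $ i $ l * x $ l) = 0"
    using arg_cong[OF assms, of "\<lambda>v. v $ i"] by (simp add: matrix_vector_mult_def)
  then have "B $ i $ k * x $ k = - (\<Sum>l\<in>UNIV - {k}. B $ i $ l * x $ l)"
    using sum.remove[of UNIV k "\<lambda>l. B $ i $ l * x $ l"] by (simp add: eq_neg_iff_add_eq_0)
  then have "cmod (B $ i $ k * x $ k) = cmod (\<Sum>l\<in>UNIV - {k}. B $ i $ l * x $ l)"
    by simp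
  also have "\<dots> \<le> (\<Sum>l\<in>UNIV - {k}. cmod (B $ i $ l * x $ l))"
    by (rule norm_sum)
  finally show ?thesis
    by (simp add: norm_mult)
qed

lemma weighted_sum_le:
  fixes B :: "complex^'n^'m" and x :: "complex^'n"
  assumes "\<And>l. l \<in> T \<Longrightarrow> cmod (x $ l) \<le> c"
  shows "(\<Sum>l\<in>T. cmod (B $ i $ l) * cmod (x $ l)) \<le> (\<Sum>l\<in>T. cmod (B $ i $ l)) * c"
  unfolding sum_distrib_right using assms by (intro sum_mono mult_left_mono) auto

lemma diagonal_entry_bound:
  fixes B :: "complex^'n^'n"
  assumes "B *v x = 0" "i \<in> S"
    and a: "\<And>l. l \<in> S \<Longrightarrow> cmod (x $ l) \<le> a"
    and b: "\<And>l. l \<in> - S \<Longrightarrow> cmod (x $ l) \<le> b"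
  shows "cmod (B $ i $ i) * cmod (x $ i) \<le> row_sum S B i * a + row_sum (- S) B i * b"
proof -
  let ?f = "\<lambda>l. cmod (B $ i $ l) * cmod (x $ l)"
  have split: "UNIV - {i} = (S - {i}) \<union> (- S - {i})"
    by auto
  have "sum ?f (UNIV - {i}) = sum ?f (S - {i}) + sum ?f (- S - {i})"
    unfolding split by (rule sum.union_disjoint) auto
  moreover have "sum ?f (S - {i}) \<le> row_sum S B i * a" "sum ?f (- S - {i}) \<le> row_sum (- S) B i * b"
    unfolding row_sum_def by (auto intro!: weighted_sum_le a b)
  ultimately show ?thesis
    using norm_entry_le_rest[OF assms(1), of i i] by linarith
qed

text \<open>Isolate column \<open>j\<close> in row \<open>i\<close>. The columns of
  \<open>- S - {j}\<close> contribute at most \<open>row_sum (- S) B i - cmod (B $ i $ j)\<close>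
  times \<open>cmod (x $ j)\<close>; moving this to the left produces the factor 2. The diagonal
  entry now counts among the columns of \<open>S\<close>.\<close>

lemma off_diagonal_entry_bound:
  fixes B :: "complex^'n^'n"
  assumes "B *v x = 0" "i \<in> S" "j \<in> - S"
    and a: "\<And>l. l \<in> S \<Longrightarrow> cmod (x $ l) \<le> a"
    and b: "\<And>l. l \<in> - S \<Longrightarrow> cmod (x $ l) \<le> cmod (x $ j)"
  shows "(2 * cmod (B $ i $ j) - row_sum (- S) B i) * cmod (x $ j)
    \<le> (cmod (B $ i $ i) + row_sum S B i) * a"
proof -
  let ?f = "\<lambda>l. cmod (B $ i $ l) * cmod (x $ l)"
  have split: "UNIV - {j} = S \<union> (- S - {j})"
    using assms(3) by auto
  have "sum ?f (UNIV - {j}) = sum ?f S + sum ?f (- S - {j})"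
    unfolding split by (rule sum.union_disjoint) auto
  moreover have "sum ?f S \<le> (\<Sum>l\<in>S. cmod (B $ i $ l)) * a"
    by (intro weighted_sum_le a)
  moreover have "(\<Sum>l\<in>S. cmod (B $ i $ l)) = cmod (B $ i $ i) + row_sum S B i"
    unfolding row_sum_def by (rule sum.remove) (use assms(2) in auto)
  moreover have "sum ?f (- S - {j}) \<le> (\<Sum>l\<in>- S - {j}. cmod (B $ i $ l)) * cmod (x $ j)"
    by (intro weighted_sum_le b) auto
  moreover have "row_sum (- S) B i = cmod (B $ i $ j) + (\<Sum>l\<in>- S - {j}. cmod (B $ i $ l))"
    unfolding row_sum_def using assms(2,3) by (simp add: sum.remove[of "- S" j])
  ultimately show ?thesis
    using norm_entry_le_rest[OF assms(1), of i j] by (simp add: algebra_simps)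
qed

text \<open>Truncation at 0 makes both inequalities safe to multiply, and \<open>a * b\<close>
  cancels when it is positive. If only one of \<open>a\<close>, \<open>b\<close> is positive, its
  inequality forces \<open>p\<close> or \<open>p'\<close> to be nonpositive, and the left side
  vanishes.\<close>

lemma cross_mult_le:
  fixes a b p p' q q' :: "'a::linordered_idom"
  assumes "p * a \<le> q * b" "p' * b \<le> q' * a" "a > 0 \<or> b > 0"
    and nonneg: "a \<ge> 0" "b \<ge> 0" "q \<ge> 0" "q' \<ge> 0"
  shows "max 0 p * max 0 p' \<le> q * q'"
proof (cases "a > 0 \<and> b > 0")
  case True
  have "max 0 p * a \<le> q * b" "max 0 p' * b \<le> q' * a"
    using assms by (auto simp: max_def)
  then have "(max 0 p * a) * (max 0 p' * b) \<le> (q * b) * (q' * a)"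
    by (rule mult_mono) (simp_all add: nonneg)
  then have "(max 0 p * max 0 p') * (a * b) \<le> (q * q') * (a * b)"
    by (simp only: mult_ac)
  then show ?thesis
    using True by (simp only: mult_le_cancel_right_pos mult_pos_pos)
next
  case False
  then have "p \<le> 0 \<or> p' \<le> 0"
    using assms by (metis less_le_not_le linorder_le_cases mult_le_0_iff mult_zero_right order_antisym)
  then show ?thesis
    using nonneg by (auto simp: max_absorb1)
qed

lemma singular_in_Omega_set:
  assumes "det (P \<mu>) = 0"
  shows "\<mu> \<in> Omega_set P"
proof -
  let ?B = "P \<mu>"
  obtain x where x: "?B *v x = 0" "x \<noteq> 0"
    using assms by (rule singular_obtains_null_vector)
  obtain i where i: "\<And>l. cmod (x $ l) \<le> cmod (x $ i)"
    using norm_maximal_index[of UNIV x] by auto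
  obtain l where "x $ l \<noteq> 0"
    using x(2) by (auto simp: vec_eq_iff)
  then have pos: "cmod (x $ i) > 0"
    using i[of l] by (meson less_le_trans zero_less_norm_iff)
  \<comment> \<open>With \<open>S = UNIV\<close> the complement is empty, so 0 is a vacuous bound
    there.\<close>
  have "cmod (?B $ i $ i) * cmod (x $ i) \<le> row_sum UNIV ?B i * cmod (x $ i)"
    using diagonal_entry_bound[OF x(1), of i UNIV "cmod (x $ i)" 0] i by (simp add: row_sum_def)
  then have "cmod (?B $ i $ i) \<le> row_sum UNIV ?B i"
    using pos by simp
  moreover have "2 * cmod (?B $ j $ i) - row_sum UNIV ?B j \<le> cmod (?B $ j $ j)" if "j \<noteq> i" for j
  proof -
    \<comment> \<open>Row \<open>j\<close> is split by the singleton \<open>{j}\<close>, so that the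
      maximal index \<open>i\<close> lies in the complement.\<close>
    have "(2 * cmod (?B $ j $ i) - row_sum (- {j}) ?B j) * cmod (x $ i)
      \<le> (cmod (?B $ j $ j) + row_sum {j} ?B j) * cmod (x $ i)"
      using that i by (intro off_diagonal_entry_bound x) auto
    moreover have "row_sum (- {j}) ?B j = row_sum UNIV ?B j" "row_sum {j} ?B j = 0"
      by (simp_all add: row_sum_def Compl_eq_Diff_UNIV)
    ultimately show ?thesis
      using pos by simp
  qed
  ultimately show ?thesis
    unfolding Omega_set_def Gamma_set_def Delta_set_def by (auto simp: not_less intro!: exI[of _ i])
qed

lemma singular_in_W_set_minus_Psi_set:
  assumes "det (P \<mu>) = 0" "S \<noteq> {}" "S \<noteq> UNIV"
  obtains i j where "i \<in> S" "j \<in> - S" "\<mu> \<in> W_set S i j P - Psi_set S i j P"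
proof -
  let ?B = "P \<mu>"
  obtain x where x: "?B *v x = 0" "x \<noteq> 0"
    using assms(1) by (rule singular_obtains_null_vector)
  obtain i where i: "i \<in> S" "\<And>l. l \<in> S \<Longrightarrow> cmod (x $ l) \<le> cmod (x $ i)"
    using norm_maximal_index[OF assms(2), of x] by blast
  obtain j where j: "j \<in> - S" "\<And>l. l \<in> - S \<Longrightarrow> cmod (x $ l) \<le> cmod (x $ j)"
    using norm_maximal_index[of "- S" x] assms(3) by blast
  obtain l where "x $ l \<noteq> 0"
    using x(2) by (auto simp: vec_eq_iff)
  then have pos: "cmod (x $ i) > 0 \<or> cmod (x $ j) > 0"
    using i(2)[of l] j(2)[of l] by (meson ComplI less_le_trans zero_less_norm_iff)
  have "(cmod (?B $ i $ i) - row_sum S ?B i) * cmod (x $ i) \<le> row_sum (- S) ?B i * cmod (x $ j)"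
    using diagonal_entry_bound[OF x(1) i(1) i(2) j(2)] by (simp add: algebra_simps)
  \<comment> \<open>The same bound with \<open>S\<close> and \<open>- S\<close> exchanged.\<close>
  moreover have "(cmod (?B $ j $ j) - row_sum (- S) ?B j) * cmod (x $ j)
      \<le> row_sum S ?B j * cmod (x $ i)"
    using diagonal_entry_bound[OF x(1) j(1) j(2), of "cmod (x $ i)"] i(2)
    by (simp add: algebra_simps)
  ultimately have "\<mu> \<in> W_set S i j P"
    unfolding W_set_def mem_Collect_eq using pos by (rule cross_mult_le) (simp_all add: row_sum_nonneg)
  moreover have "(2 * cmod (?B $ i $ j) - row_sum (- S) ?B i) * cmod (x $ j)
      \<le> (cmod (?B $ i $ i) + row_sum S ?B i) * cmod (x $ i)"
    by (intro off_diagonal_entry_bound x i j)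
  moreover have "(2 * cmod (?B $ j $ i) - row_sum S ?B j) * cmod (x $ i)
      \<le> (cmod (?B $ j $ j) + row_sum (- S) ?B j) * cmod (x $ j)"
    using off_diagonal_entry_bound[OF x(1) j(1), of i "cmod (x $ j)"] i j(2) by simp
  \<comment> \<open>The moduli at \<open>i\<close> and \<open>j\<close> trade places in
    \<open>cross_mult_le\<close>; its conclusion negates the strict inequality of
    \<open>Psi_set\<close>.\<close>
  ultimately have "\<mu> \<in> W_set S i j P - Psi_set S i j P"
    using cross_mult_le[of "2 * cmod (?B $ i $ j) - row_sum (- S) ?B i" "cmod (x $ j)"
        "cmod (?B $ i $ i) + row_sum S ?B i" "cmod (x $ i)"
        "2 * cmod (?B $ j $ i) - row_sum S ?B j" "cmod (?B $ j $ j) + row_sum (- S) ?B j"] pos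
    by (simp add: Psi_set_def row_sum_nonneg disj_commute)
  with i(1) j(1) that show ?thesis
    by blast
qed

lemma singular_in_Xi_finite:
  assumes "det (P \<mu>) = 0"
  shows "\<mu> \<in> Xi_finite P"
  unfolding Xi_finite_def
proof clarify
  fix S :: "'a set"
  assume "S \<noteq> {}"
  show "\<mu> \<in> Xi_S S P"
  proof (cases "S = UNIV")
    case True
    then show ?thesis
      using singular_in_Omega_set[of P] assms by (simp add: Xi_S_def)
  next
    case False
    with assms \<open>S \<noteq> {}\<close> obtain i j
      where "i \<in> S" "j \<in> - S" "\<mu> \<in> W_set S i j P - Psi_set S i j P"
      by (rule singular_in_W_set_minus_Psi_set)
    with False show ?thesis
      unfolding Xi_S_def by auto
  qed
qed

theorem theorem6p2:
  fixes A :: "nat \<Rightarrow> complex^'n^'n" and m :: nat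
  assumes "A m \<noteq> 0"
    and "\<exists>z. det (mpoly_eval m A z) \<noteq> 0"
  shows "{e. mpoly_eigenvalue m A e} \<subseteq> CKV_set m A"
proof
  fix e
  assume "e \<in> {e. mpoly_eigenvalue m A e}"
  then show "e \<in> CKV_set m A"
    \<comment> \<open>For \<open>Infty\<close>, the inclusion is applied to the reversed polynomial
      at 0.\<close>
    by (cases e) (auto simp: finite_eigenvalue_def CKV_set_def intro: singular_in_Xi_finite)
qed

end
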